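(* Let $H$ be a Hilbert space. Then the class $\mathcal{C}_{NE}(H)$ of all nonexpansive mappings $T:H\to H$ is an unsaturated class of mappings, i.e. the inclusion $\mathcal{C}_{NE}(H)\subset \mathcal{C}_{NE}^{e}(H)$ is strict.
   Context: For a self mapping $T:X\to X$ of a linear normed space $(X,\|\cdot\|)$ and $\lambda\in(0,1]$, the averaged mapping $T_\lambda:X\to X$ is $T_\lambda x=(1-\lambda)x+\lambda Tx$. If $\mathcal{C}$ is a subset of the family of all self mappings of $X$, a mapping $T:X\to X$ is called $\mathcal{C}$-enriched if there exists $\lambda\in(0,1]$ such that $T_\lambda\in\mathcal{C}$; $\mathcal{C}^{e}$ denotes the set of all $\mathcal{C}$-enriched mappings. One always has $\mathcal{C}\subseteq\mathcal{C}^{e}$ (take $\lambda=1$). The class $\mathcal{C}$ is called unsaturated if the inclusion $\mathcal{C}\subset\mathcal{C}^{e}$ is strict, and saturated if $\mathcal{C}=\mathcal{C}^{e}$. A mapping $T:X\to X$ is nonexpansive if $\|Tx-Ty\|\le\|x-y\|$ for all $x,y\in X$. $\mathcal{C}_{NE}(X)$ denotes the class of all nonexpansive self mappings of $X$, and $\mathcal{C}_{NE}^{e}(X)=(\mathcal{C}_{NE}(X))^{e}$.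
   Formalization: The formal theorem assumes that the Hilbert space H is not the zero space; on H = {0} the only self mapping is the identity, so the inclusion is an equality and the claim fails. *)

theory Defs
  imports "HOL-Analysis.Analysis"
begin

definition averaged :: "real \<Rightarrow> ('a::real_normed_vector \<Rightarrow> 'a) \<Rightarrow> 'a \<Rightarrow> 'a" where
  "averaged lam T = (\<lambda>x. (1 - lam) *\<^sub>R x + lam *\<^sub>R T x)"

definition enriched :: "('a::real_normed_vector \<Rightarrow> 'a) set \<Rightarrow> ('a \<Rightarrow> 'a) set" where
  "enriched C = {T. \<exists>lam\<in>{0<..1}. averaged lam T \<in> C}"

definition unsaturated :: "('a::real_normed_vector \<Rightarrow> 'a) set \<Rightarrow> bool" where
  "unsaturated C \<longleftrightarrow> C \<subset> enriched C"

definition nonexpansive :: "('a::real_normed_vector \<Rightarrow> 'a) \<Rightarrow> bool" where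
  "nonexpansive T \<longleftrightarrow> (\<forall>x y. norm (T x - T y) \<le> norm (x - y))"

definition nonexpansive_class :: "('a::real_normed_vector \<Rightarrow> 'a) set" where
  "nonexpansive_class = {T. nonexpansive T}"

end

theory Submission imports Defs begin

text \<open>Weight 1 gives the inclusion; one witness makes it strict. Averaging turns
  multiplication by \<open>c\<close> into multiplication by \<open>1 - lam + lam * c\<close>, so a
  scalar \<open>c < -1\<close>, which expands distances, is pulled to 0 by
  \<open>lam = 1 / (1 - c)\<close>; here \<open>c = -2\<close>.\<close>

text \<open>The map \<open>x \<mapsto> -2x\<close> expands distances, but its average with weight \<open>1/3\<close> is the zero map.\<close>

lemma nonexpansive_subset_enriched: "nonexpansive_class \<subseteq> enriched nonexpansive_class"
proof
  fix T :: "'a \<Rightarrow> 'a"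
  assume "T \<in> nonexpansive_class"
  moreover have "averaged 1 T = T"
    by (simp add: averaged_def)
  ultimately show "T \<in> enriched nonexpansive_class"
    unfolding enriched_def by (auto intro!: bexI[of _ 1])
qed

lemma scale_minus_two_enriched:
  "(\<lambda>x::'a::real_normed_vector. (-2) *\<^sub>R x) \<in> enriched nonexpansive_class"
proof -
  have "averaged (1/3) (\<lambda>x::'a. (-2) *\<^sub>R x) = (\<lambda>x. 0)"
    by (simp add: averaged_def)
  then show ?thesis
    unfolding enriched_def
    by (auto simp: nonexpansive_class_def nonexpansive_def intro!: bexI[of _ "1/3"])
qed

text \<open>A nonzero vector is essential: on the zero space the only self map is
  nonexpansive.\<close>

lemma scale_minus_two_not_nonexpansive:
  fixes x :: "'a::real_normed_vector"
  assumes "x \<noteq> 0"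
  shows "\<not> nonexpansive (\<lambda>x::'a. (-2) *\<^sub>R x)"
proof
  assume "nonexpansive (\<lambda>x::'a. (-2) *\<^sub>R x)"
  \<comment> \<open>Comparing \<open>x\<close> with the fixed point 0 gives
    \<open>2 * norm x \<le> norm x\<close>, which forces \<open>x = 0\<close>.\<close>
  then have "norm ((-2) *\<^sub>R x - (-2) *\<^sub>R 0) \<le> norm (x - 0)"
    unfolding nonexpansive_def by blast
  with assms show False by simp
qed

theorem proposition11:
  assumes nontrivial: "\<exists>x::'a::{real_inner, complete_space}. x \<noteq> 0"
  shows "unsaturated (nonexpansive_class :: ('a \<Rightarrow> 'a) set)"
proof -
  from nontrivial obtain x :: 'a where "x \<noteq> 0" by blast
  then have "(\<lambda>x::'a. (-2) *\<^sub>R x) \<notin> nonexpansive_class"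
    using scale_minus_two_not_nonexpansive by (simp add: nonexpansive_class_def)
  then show ?thesis
    unfolding unsaturated_def
    using nonexpansive_subset_enriched scale_minus_two_enriched by blast
qed

end
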